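(* Let $0\le\psi<\phi\le\pi/2$ and $0<\theta\le 2\phi$. Then $$R(\theta,[\psi,\phi])=R(\theta,\phi)=R(\omega(\theta,\phi)),$$ meaning that these equalities hold for the upper rates, $R^+(\theta,[\psi,\phi])=R^+(\theta,\phi)=R^+(\omega(\theta,\phi))$, and for the lower rates, $R^-(\theta,[\psi,\phi])=R^-(\theta,\phi)=R^-(\omega(\theta,\phi))$.
   Context: $S^{n-1}$ is the unit sphere in $\mathbb R^n$, $e_n=(0,\dots,0,1)$, $\operatorname{dist}$ is angular distance. $Z(n,[\psi,\phi])=\{x\in S^{n-1}:\cos\phi\le\langle x,e_n\rangle\le\cos\psi\}$ is a spherical strip and $\mathrm{Cap}(n,\phi)=Z(n,[0,\phi])$ a spherical cap. A finite set $C\subset S^{n-1}$ is a $\theta$-code if $\operatorname{dist}(x,y)\ge\theta$ for all distinct $x,y\in C$. $A(n,\theta)$, $A(n,\theta,\phi)$, $A(n,\theta,[\psi,\phi])$ denote the maximum sizes of $\theta$-codes contained in $S^{n-1}$, $\mathrm{Cap}(n,\phi)$, $Z(n,[\psi,\phi])$, respectively. The rates are $$R^+(\theta)=\limsup_{n\to\infty}\tfrac1n\ln A(n,\theta),\qquad R^-(\theta)=\liminf_{n\to\infty}\tfrac1n\ln A(n,\theta),$$ and $R^\pm(\theta,\phi)$, $R^\pm(\theta,[\psi,\phi])$ are defined in the same way from $A(n,\theta,\phi)$ and $A(n,\theta,[\psi,\phi])$. The angle $\omega(\theta,\phi)\in[0,\pi]$ is defined by $\cos\omega(\theta,\phi)=\dfrac{\cos\theta-\cos^2\phi}{\sin^2\phi}$.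 *)

theory Defs
  imports "Jordan_Normal_Form.Matrix" "HOL-Library.Extended_Real" Complex_Main
begin

text \<open>The dimension \<open>n\<close> varies (the rates are limits as \<open>n\<close> tends to infinity), so points of
  \<open>n\<close>-space are elements of \<open>carrier_vec n\<close>, with coordinates indexed by \<open>0, \<dots>, n - 1\<close>.\<close>

definition unit_sphere :: "nat \<Rightarrow> real vec set" where
  "unit_sphere n = {x \<in> carrier_vec n. x \<bullet> x = 1}"

text \<open>Angular distance; meaningful for unit vectors only.\<close>

definition ang_dist :: "real vec \<Rightarrow> real vec \<Rightarrow> real" where
  "ang_dist x y = arccos (x \<bullet> y)"

text \<open>With 0-based coordinates, the last basis vector of \<open>n\<close>-space is \<open>unit_vec n (n - 1)\<close>.
  For \<open>n = 0\<close> the sphere is empty, so the truncated subtraction does not matter.\<close>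

definition strip :: "nat \<Rightarrow> real \<Rightarrow> real \<Rightarrow> real vec set" where
  "strip n \<psi> \<phi> = {x \<in> unit_sphere n.
     cos \<phi> \<le> x \<bullet> unit_vec n (n - 1) \<and> x \<bullet> unit_vec n (n - 1) \<le> cos \<psi>}"

definition cap :: "nat \<Rightarrow> real \<Rightarrow> real vec set" where
  "cap n \<phi> = strip n 0 \<phi>"

definition spherical_code :: "nat \<Rightarrow> real \<Rightarrow> real vec set \<Rightarrow> bool" where
  "spherical_code n \<theta> C \<longleftrightarrow>
     finite C \<and> C \<subseteq> unit_sphere n \<and> (\<forall>x\<in>C. \<forall>y\<in>C. x \<noteq> y \<longrightarrow> \<theta> \<le> ang_dist x y)"

text \<open>The set of sizes is nonempty (it contains 0), and it is finite whenever \<open>\<theta> > 0\<close>, so that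
  the maximum is then attained; for \<open>\<theta> \<le> 0\<close> the value is in general unspecified.\<close>

definition max_code_size :: "nat \<Rightarrow> real \<Rightarrow> real vec set \<Rightarrow> nat" where
  "max_code_size n \<theta> X = Max {card C |C. spherical_code n \<theta> C \<and> C \<subseteq> X}"

definition A_sphere :: "nat \<Rightarrow> real \<Rightarrow> nat" where
  "A_sphere n \<theta> = max_code_size n \<theta> (unit_sphere n)"

definition A_cap :: "nat \<Rightarrow> real \<Rightarrow> real \<Rightarrow> nat" where
  "A_cap n \<theta> \<phi> = max_code_size n \<theta> (cap n \<phi>)"

definition A_strip :: "nat \<Rightarrow> real \<Rightarrow> real \<Rightarrow> real \<Rightarrow> nat" where
  "A_strip n \<theta> \<psi> \<phi> = max_code_size n \<theta> (strip n \<psi> \<phi>)"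

text \<open>Rates are taken in the extended reals, so no boundedness is presupposed. The junk values at
  \<open>n = 0\<close> (division by 0) and at those \<open>n\<close> where the size is 0 (\<open>ln 0 = 0\<close>; for the sets used
  here this needs \<open>n \<le> 1\<close>) affect finitely many terms only.\<close>

definition upper_rate :: "(nat \<Rightarrow> nat) \<Rightarrow> ereal" where
  "upper_rate a = limsup (\<lambda>n. ereal (1 / real n * ln (real (a n))))"

definition lower_rate :: "(nat \<Rightarrow> nat) \<Rightarrow> ereal" where
  "lower_rate a = liminf (\<lambda>n. ereal (1 / real n * ln (real (a n))))"

definition R_upper :: "real \<Rightarrow> ereal" where
  "R_upper \<theta> = upper_rate (\<lambda>n. A_sphere n \<theta>)"

definition R_lower :: "real \<Rightarrow> ereal" where
  "R_lower \<theta> = lower_rate (\<lambda>n. A_sphere n \<theta>)"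

definition R_upper_cap :: "real \<Rightarrow> real \<Rightarrow> ereal" where
  "R_upper_cap \<theta> \<phi> = upper_rate (\<lambda>n. A_cap n \<theta> \<phi>)"

definition R_lower_cap :: "real \<Rightarrow> real \<Rightarrow> ereal" where
  "R_lower_cap \<theta> \<phi> = lower_rate (\<lambda>n. A_cap n \<theta> \<phi>)"

definition R_upper_strip :: "real \<Rightarrow> real \<Rightarrow> real \<Rightarrow> ereal" where
  "R_upper_strip \<theta> \<psi> \<phi> = upper_rate (\<lambda>n. A_strip n \<theta> \<psi> \<phi>)"

definition R_lower_strip :: "real \<Rightarrow> real \<Rightarrow> real \<Rightarrow> ereal" where
  "R_lower_strip \<theta> \<psi> \<phi> = lower_rate (\<lambda>n. A_strip n \<theta> \<psi> \<phi>)"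

text \<open>The angle in \<open>[0, \<pi>]\<close> with the given cosine. The argument of \<open>arccos\<close> lies in \<open>[-1, 1]\<close>
  when \<open>0 < \<phi> \<le> \<pi> / 2\<close> and \<open>0 \<le> \<theta> \<le> 2 \<phi>\<close>.\<close>

definition omega :: "real \<Rightarrow> real \<Rightarrow> real" where
  "omega \<theta> \<phi> = arccos ((cos \<theta> - (cos \<phi>)\<^sup>2) / (sin \<phi>)\<^sup>2)"

end

theory Submission
  imports "HOL-Analysis.Extended_Real_Limits" Defs
begin

text \<open>
  Write \<open>A\<^sub>m(\<omega>)\<close> for the largest size of an \<open>\<omega>\<close>-code on the sphere of \<open>m\<close>-space, where
  \<open>\<omega> = omega \<theta> \<phi>\<close>. The boundary of the cap of angle \<open>\<phi>\<close> in \<open>(m + 1)\<close>-space is a sphere of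
  radius \<open>sin \<phi>\<close> at height \<open>cos \<phi>\<close>, and \<open>\<omega>\<close> is the angle seen from the centre of that small
  sphere when the angle seen from the origin is \<open>\<theta>\<close>. Copying an optimal \<open>\<omega>\<close>-code onto this
  boundary, which lies in every strip ending at \<open>\<phi>\<close>, gives
  \<open>A\<^sub>m(\<omega>) \<le> A_strip (m + 1) \<theta> \<psi> \<phi> \<le> A_cap (m + 1) \<theta> \<phi>\<close> (lemma \<open>A_sphere_le_A_strip\<close>). Adding one
  dimension or a constant factor does not change a rate, so it remains to bound the cap from above.

  If \<open>\<phi> = pi / 2\<close>, then \<open>\<omega> = \<theta>\<close> and the cap is part of the sphere of the same dimension.

  If \<open>\<phi> < pi / 2\<close>, there is a constant \<open>K\<close> such that, for all \<open>m \<ge> 1\<close>,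
  \<open>A_cap (m + 1) \<theta> \<phi> \<le> K * A\<^sub>m(\<omega>)\<close> (lemma \<open>A_cap_le_const_mult_A_sphere\<close>). Points of the cap are
  projected along meridians to their direction orthogonal to the axis. Let \<open>t\<close> and \<open>s\<close> be the
  cotangents of the polar angles of two points with scalar product at most \<open>c = cos \<theta>\<close>. Their
  projections have scalar product at most \<open>c * sqrt ((1 + t\<^sup>2) * (1 + s\<^sup>2)) - t * s\<close>. On the diagonal
  \<open>t = s\<close> this is \<open>c - (1 - c) * t\<^sup>2\<close>, which decreases in \<open>t\<close> and equals \<open>cos \<omega>\<close> at
  \<open>t = cot \<phi>\<close>. Off the diagonal there is a loss that is only quadratic in \<open>t - s\<close>, while the gain
  from leaving the corner \<open>t = s = cot \<phi>\<close> is linear because \<open>cot \<phi> > 0\<close>. Hence the bound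
  \<open>cos \<omega>\<close> holds exactly, not just approximately, as soon as \<open>t\<close> and \<open>s\<close> differ by at most the fixed
  amount \<open>2 * (1 - c) * cot \<phi>\<close> (lemma \<open>radial_projection_bound\<close>). A code has at most one point very near the pole, and finitely many
  strips of that fixed width in the cotangent cover the rest of the cap.
\<close>

no_notation inner (infix \<open>\<bullet>\<close> 70)
no_notation vec_nth (infixl \<open>$\<close> 90)

section \<open>Spherical codes in terms of scalar products\<close>

lemma unit_sphereD:
  assumes "x \<in> unit_sphere n"
  shows "x \<in> carrier_vec n" "dim_vec x = n" "x \<bullet> x = 1"
  using assms by (auto simp: unit_sphere_def)

lemma sum_coordinate_squares:
  fixes x y :: "real vec"
  assumes "dim_vec x = n" "dim_vec y = n"
  shows "(\<Sum>i<n. (x $ i - y $ i)\<^sup>2) = x \<bullet> x + y \<bullet> y - 2 * (x \<bullet> y)"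
    and "(\<Sum>i<n. (x $ i + y $ i)\<^sup>2) = x \<bullet> x + y \<bullet> y + 2 * (x \<bullet> y)"
  using assms
  by (simp_all add: scalar_prod_def power2_eq_square algebra_simps sum.distrib sum_subtractf
      sum_distrib_left atLeast0LessThan)

text \<open>A form of the Cauchy--Schwarz inequality that suffices for unit vectors.\<close>

lemma abs_scalar_prod_le:
  fixes x y :: "real vec"
  assumes "dim_vec x = n" "dim_vec y = n"
  shows "2 * \<bar>x \<bullet> y\<bar> \<le> x \<bullet> x + y \<bullet> y"
proof -
  have "0 \<le> (\<Sum>i<n. (x $ i - y $ i)\<^sup>2)" "0 \<le> (\<Sum>i<n. (x $ i + y $ i)\<^sup>2)"
    by (auto intro: sum_nonneg)
  then show ?thesis
    using sum_coordinate_squares[OF assms] by linarith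
qed

lemma le_ang_dist_iff:
  assumes "x \<in> unit_sphere n" "y \<in> unit_sphere n" "0 \<le> \<theta>" "\<theta> \<le> pi"
  shows "\<theta> \<le> ang_dist x y \<longleftrightarrow> x \<bullet> y \<le> cos \<theta>"
proof -
  have "\<bar>x \<bullet> y\<bar> \<le> 1"
    using abs_scalar_prod_le[of x n y] unit_sphereD[OF assms(1)] unit_sphereD[OF assms(2)] by simp
  then have "arccos (x \<bullet> y) \<in> {0..pi}" "cos (arccos (x \<bullet> y)) = x \<bullet> y"
    by (auto simp: arccos_lbound arccos_ubound)
  with cos_mono_le_eq[of "arccos (x \<bullet> y)" \<theta>] assms show ?thesis
    by (auto simp: ang_dist_def)
qed

lemma spherical_code_iff:
  assumes "0 \<le> \<theta>" "\<theta> \<le> pi"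
  shows "spherical_code n \<theta> C \<longleftrightarrow>
    finite C \<and> C \<subseteq> unit_sphere n \<and> (\<forall>x\<in>C. \<forall>y\<in>C. x \<noteq> y \<longrightarrow> x \<bullet> y \<le> cos \<theta>)"
  unfolding spherical_code_def using le_ang_dist_iff[OF _ _ assms] by (meson subsetD)

lemma cos_less_one:
  fixes \<theta> :: real
  assumes "0 < \<theta>" "\<theta> \<le> pi"
  shows "cos \<theta> < 1"
  using cos_monotone_0_pi[of 0 \<theta>] assms by simp

section \<open>Maximum code sizes\<close>

lemma grid_cell_close:
  fixes N :: nat and a b :: real
  assumes "N > 0" "\<lfloor>a * N\<rfloor> = \<lfloor>b * N\<rfloor>"
  shows "(a - b)\<^sup>2 \<le> 1 / (real N)\<^sup>2"
proof -
  have "\<bar>a * N - b * N\<bar> \<le> 1"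
    using assms(2) by linarith
  then have "(a * N - b * N)\<^sup>2 \<le> 1"
    by (metis abs_le_square_iff abs_one one_power2)
  then have "(a - b)\<^sup>2 * (real N)\<^sup>2 \<le> 1"
    by (simp add: power_mult_distrib[symmetric] left_diff_distrib)
  then show ?thesis
    using assms(1) by (simp add: field_simps)
qed

text \<open>Two points of a code cannot share a cell of a sufficiently fine cubical grid, and finitely many
  cells meet the sphere. With this bound, the maxima that define code sizes range over finite sets.\<close>

lemma spherical_code_card_bounded:
  assumes "0 < \<theta>" "\<theta> \<le> pi"
  shows "\<exists>B. \<forall>C. spherical_code n \<theta> C \<longrightarrow> card C \<le> B"
proof -
  \<comment> \<open>The least possible squared Euclidean distance between two points of a code. Points in one
    cell of side \<open>1 / N\<close> have squared distance at most \<open>n / N\<^sup>2\<close>.\<close>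
  define d where "d = 2 - 2 * cos \<theta>"
  have d: "d > 0"
    using cos_less_one[OF assms] by (simp add: d_def)
  obtain N0 :: nat where N0: "n / d < N0"
    using reals_Archimedean2 by blast
  define N where "N = Suc N0"
  have N: "N > 0" "n / d < N"
    using N0 by (auto simp: N_def)
  have "real n < d * N"
    using N(2) d by (simp add: field_simps)
  also have "\<dots> \<le> d * (real N)\<^sup>2"
    using N(1) d by (simp add: power2_eq_square)
  finally have small: "n * (1 / (real N)\<^sup>2) < d"
    using N(1) by (simp add: field_simps)
  define cell where "cell x = (\<lambda>i\<in>{..<n}. \<lfloor>x $ i * N\<rfloor>)" for x :: "real vec"
  define G where "G = (\<Pi>\<^sub>E i\<in>{..<n}. {- int N .. int N})"
  have G: "finite G"
    by (simp add: G_def finite_PiE)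
  have "card C \<le> card G" if C: "spherical_code n \<theta> C" for C
  proof -
    have C': "C \<subseteq> unit_sphere n" "\<And>x y. x \<in> C \<Longrightarrow> y \<in> C \<Longrightarrow> x \<noteq> y \<Longrightarrow> x \<bullet> y \<le> cos \<theta>"
      using C assms by (auto simp: spherical_code_iff)
    have "inj_on cell C"
    proof (rule inj_onI, rule ccontr)
      fix x y assume xy: "x \<in> C" "y \<in> C" "cell x = cell y" "x \<noteq> y"
      have "\<lfloor>x $ i * N\<rfloor> = \<lfloor>y $ i * N\<rfloor>" if "i < n" for i
        using fun_cong[OF xy(3), of i] that by (simp add: cell_def)
      then have "(\<Sum>i<n. (x $ i - y $ i)\<^sup>2) \<le> (\<Sum>i<n. 1 / (real N)\<^sup>2)"
        using grid_cell_close[OF N(1)] by (intro sum_mono) auto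
      then have "2 - 2 * (x \<bullet> y) \<le> n * (1 / (real N)\<^sup>2)"
        using sum_coordinate_squares(1)[of x n y] unit_sphereD[of x n] unit_sphereD[of y n] C'(1) xy
        by (auto simp: subset_iff)
      then show False
        using C'(2)[of x y] xy small by (simp add: d_def)
    qed
    moreover have "cell ` C \<subseteq> G"
    proof
      fix g assume "g \<in> cell ` C"
      then obtain x where x: "x \<in> unit_sphere n" "g = cell x"
        using C'(1) by auto
      have "\<lfloor>x $ i * N\<rfloor> \<in> {- int N .. int N}" if "i < n" for i
      proof -
        have "(x $ i)\<^sup>2 \<le> (\<Sum>j<n. (x $ j)\<^sup>2)"
          using that by (intro member_le_sum) auto
        also have "\<dots> = x \<bullet> x"
          using unit_sphereD[OF x(1)] by (simp add: scalar_prod_def power2_eq_square atLeast0LessThan)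
        finally have "\<bar>x $ i\<bar> \<le> 1"
          using unit_sphereD[OF x(1)] by (simp add: abs_square_le_1)
        then have "- real N \<le> x $ i * N" "x $ i * N \<le> N"
          using mult_right_mono[of "-1" "x $ i" "real N"] mult_right_mono[of "x $ i" 1 "real N"]
          by auto
        then show ?thesis
          by (auto simp: le_floor_iff floor_le_iff)
      qed
      then show "g \<in> G"
        by (auto simp: x(2) cell_def G_def)
    qed
    ultimately show ?thesis
      using G by (metis card_image card_mono)
  qed
  then show ?thesis by blast
qed

lemma finite_code_sizes:
  assumes "0 < \<theta>" "\<theta> \<le> pi"
  shows "finite {card C |C. spherical_code n \<theta> C \<and> C \<subseteq> X}"
proof -
  obtain B where "\<forall>C. spherical_code n \<theta> C \<longrightarrow> card C \<le> B"
    using spherical_code_card_bounded[OF assms] by blast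
  then have "{card C |C. spherical_code n \<theta> C \<and> C \<subseteq> X} \<subseteq> {..B}"
    by auto
  then show ?thesis
    using finite_subset by blast
qed

lemma card_le_max_code_size:
  assumes "0 < \<theta>" "\<theta> \<le> pi" "spherical_code n \<theta> C" "C \<subseteq> X"
  shows "card C \<le> max_code_size n \<theta> X"
  unfolding max_code_size_def using finite_code_sizes[OF assms(1,2)] assms(3,4)
  by (intro Max_ge) auto

lemma max_code_size_attained:
  assumes "0 < \<theta>" "\<theta> \<le> pi"
  obtains C where "spherical_code n \<theta> C" "C \<subseteq> X" "card C = max_code_size n \<theta> X"
proof -
  have "spherical_code n \<theta> {}"
    by (simp add: spherical_code_def)
  then have "{card C |C. spherical_code n \<theta> C \<and> C \<subseteq> X} \<noteq> {}"
    by blast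
  from Max_in[OF finite_code_sizes[OF assms] this] that show ?thesis
    by (auto simp: max_code_size_def)
qed

lemma max_code_size_mono:
  assumes "0 < \<theta>" "\<theta> \<le> pi" "X \<subseteq> Y"
  shows "max_code_size n \<theta> X \<le> max_code_size n \<theta> Y"
  using max_code_size_attained[OF assms(1,2)] card_le_max_code_size[OF assms(1,2)] assms(3)
  by (metis subset_trans)

text \<open>All comparisons of code sizes go through this: a map that sends distinct points to points at
  angle at least \<open>\<theta> > 0\<close> is injective, so its image is a code of the same size.\<close>

lemma card_le_max_code_size_image:
  assumes \<theta>: "0 < \<theta>" "\<theta> \<le> pi" and "finite C"
    and f: "\<And>x. x \<in> C \<Longrightarrow> f x \<in> unit_sphere n" "\<And>x. x \<in> C \<Longrightarrow> f x \<in> X"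
    and sep: "\<And>x y. x \<in> C \<Longrightarrow> y \<in> C \<Longrightarrow> x \<noteq> y \<Longrightarrow> f x \<bullet> f y \<le> cos \<theta>"
  shows "card C \<le> max_code_size n \<theta> X"
proof -
  have "inj_on f C"
  proof (rule inj_onI, rule ccontr)
    fix x y assume xy: "x \<in> C" "y \<in> C" "f x = f y" "x \<noteq> y"
    then have "f x \<bullet> f y = 1"
      using unit_sphereD(3)[OF f(1)] by metis
    then show False
      using sep[OF xy(1,2,4)] cos_less_one[OF \<theta>] by simp
  qed
  moreover have "spherical_code n \<theta> (f ` C)"
    using assms by (auto simp: spherical_code_iff)
  then have "card (f ` C) \<le> max_code_size n \<theta> X"
    using f by (intro card_le_max_code_size \<theta>) auto
  ultimately show ?thesis
    by (simp add: card_image)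
qed

lemma A_sphere_pos:
  assumes "0 < \<theta>" "\<theta> \<le> pi" "n \<ge> 1"
  shows "1 \<le> A_sphere n \<theta>"
proof -
  have u: "unit_vec n 0 \<in> unit_sphere n"
    using assms(3) by (simp add: unit_sphere_def)
  then have "spherical_code n \<theta> {unit_vec n 0}"
    by (simp add: spherical_code_def)
  from card_le_max_code_size[OF assms(1,2) this] u show ?thesis
    by (force simp: A_sphere_def)
qed

section \<open>Passing between a cap and its boundary sphere\<close>

lemma scalar_prod_Suc:
  assumes "dim_vec y = Suc m"
  shows "x \<bullet> y = (\<Sum>i<m. x $ i * y $ i) + x $ m * y $ m"
  using assms by (simp add: scalar_prod_def atLeast0LessThan)

lemma strip_Suc_iff:
  "x \<in> strip (Suc m) \<psi> \<phi> \<longleftrightarrow> x \<in> unit_sphere (Suc m) \<and> cos \<phi> \<le> x $ m \<and> x $ m \<le> cos \<psi>"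
  by (simp add: strip_def)

text \<open>The hypothesis \<open>\<theta> \<le> 2 * \<phi>\<close> says that the angle \<open>\<theta>\<close> occurs between points of the cap. It is
  what keeps the argument of \<open>arccos\<close> above \<open>-1\<close>.\<close>

lemma omega_properties:
  assumes "0 < \<phi>" "\<phi> \<le> pi / 2" "0 < \<theta>" "\<theta> \<le> 2 * \<phi>"
  shows "0 < omega \<theta> \<phi>" "omega \<theta> \<phi> \<le> pi"
    "cos (omega \<theta> \<phi>) = (cos \<theta> - (cos \<phi>)\<^sup>2) / (sin \<phi>)\<^sup>2"
proof -
  define q where "q = (cos \<theta> - (cos \<phi>)\<^sup>2) / (sin \<phi>)\<^sup>2"
  have s: "(sin \<phi>)\<^sup>2 > 0"
    using sin_gt_zero[of \<phi>] assms by simp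
  have "cos (2 * \<phi>) \<le> cos \<theta>"
    using assms by (intro cos_monotone_0_pi_le) auto
  then have q1: "-1 \<le> q"
    unfolding cos_double using s by (simp add: q_def field_simps)
  have "cos \<theta> < (sin \<phi>)\<^sup>2 + (cos \<phi>)\<^sup>2"
    using cos_less_one[of \<theta>] assms by simp
  then have q2: "q < 1"
    using s by (simp add: q_def field_simps)
  show "cos (omega \<theta> \<phi>) = (cos \<theta> - (cos \<phi>)\<^sup>2) / (sin \<phi>)\<^sup>2" "omega \<theta> \<phi> \<le> pi" "0 < omega \<theta> \<phi>"
    using q1 q2 arccos_less_arccos[of q 1] arccos_ubound[of q]
    by (auto simp: omega_def q_def[symmetric])
qed

text \<open>The map \<open>y \<mapsto> (sin \<phi> y, cos \<phi>)\<close> onto the boundary of the cap turns the scalar product \<open>p\<close>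
  into \<open>(sin \<phi>)\<^sup>2 * p + (cos \<phi>)\<^sup>2\<close>, and \<open>omega\<close> is defined so that \<open>cos (omega \<theta> \<phi>)\<close> becomes
  \<open>cos \<theta>\<close>.\<close>

lemma A_sphere_le_A_strip:
  assumes "0 \<le> \<psi>" "\<psi> < \<phi>" "\<phi> \<le> pi / 2" "0 < \<theta>" "\<theta> \<le> 2 * \<phi>"
  shows "A_sphere m (omega \<theta> \<phi>) \<le> A_strip (Suc m) \<theta> \<psi> \<phi>"
proof -
  have \<phi>: "0 < \<phi>" and \<theta>: "0 < \<theta>" "\<theta> \<le> pi"
    using assms by auto
  note om = omega_properties[OF \<phi> assms(3-5)]
  have s: "(sin \<phi>)\<^sup>2 > 0"
    using sin_gt_zero[of \<phi>] \<phi> assms(3) by simp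
  obtain C where C: "spherical_code m (omega \<theta> \<phi>) C" "card C = A_sphere m (omega \<theta> \<phi>)"
    using max_code_size_attained[OF om(1,2)] unfolding A_sphere_def by metis
  have C': "finite C" "C \<subseteq> unit_sphere m"
    "\<And>x y. x \<in> C \<Longrightarrow> y \<in> C \<Longrightarrow> x \<noteq> y \<Longrightarrow> x \<bullet> y \<le> cos (omega \<theta> \<phi>)"
    using C(1) om by (auto simp: spherical_code_iff)
  define f where "f y = vec (Suc m) (\<lambda>i. if i < m then sin \<phi> * y $ i else cos \<phi>)"
    for y :: "real vec"
  have f_prod: "f x \<bullet> f y = (sin \<phi>)\<^sup>2 * (x \<bullet> y) + (cos \<phi>)\<^sup>2" if "dim_vec y = m" for x y
    using that by (simp add: scalar_prod_Suc f_def power2_eq_square)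
      (simp add: scalar_prod_def sum_distrib_left atLeast0LessThan mult_ac)
  have f_sphere: "f x \<in> unit_sphere (Suc m)" if "x \<in> C" for x
  proof -
    have "x \<in> unit_sphere m"
      using C'(2) that by blast
    then have "f x \<bullet> f x = 1"
      using f_prod[of x x] unit_sphereD[of x m] by simp
    then show ?thesis
      by (simp add: unit_sphere_def) (simp add: f_def)
  qed
  show ?thesis
    unfolding C(2)[symmetric] A_strip_def
  proof (rule card_le_max_code_size_image[OF \<theta> C'(1) f_sphere])
    fix x assume "x \<in> C"
    moreover have "cos \<phi> \<le> cos \<psi>"
      using assms by (intro cos_monotone_0_pi_le) auto
    ultimately show "f x \<in> strip (Suc m) \<psi> \<phi>"
      using f_sphere by (auto simp: strip_Suc_iff) (auto simp: f_def)
  next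
    fix x y assume xy: "x \<in> C" "y \<in> C" "x \<noteq> y"
    have "f x \<bullet> f y \<le> (sin \<phi>)\<^sup>2 * cos (omega \<theta> \<phi>) + (cos \<phi>)\<^sup>2"
      using f_prod[of y x] unit_sphereD(2)[of y m] C'(2,3) xy s by auto
    also have "\<dots> = cos \<theta>"
      using s by (simp add: om(3))
    finally show "f x \<bullet> f y \<le> cos \<theta>" .
  qed
qed

text \<open>The analytic core. Here \<open>t\<close> and \<open>s\<close> are the cotangents of the polar angles of two points, \<open>q\<close>
  and \<open>p\<close> are the reciprocals of the sines, and \<open>t0 = cot \<phi>\<close>. The bound on \<open>\<bar>t - s\<bar>\<close> is where the
  linear gain \<open>(1 - c) * t0 * \<bar>t - s\<bar>\<close> still pays for the quadratic loss \<open>(t - s)\<^sup>2 / 2\<close>.\<close>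

lemma radial_projection_bound:
  fixes c q p t s t0 :: real
  assumes "0 < q" "0 < p" "q\<^sup>2 = 1 + t\<^sup>2" "p\<^sup>2 = 1 + s\<^sup>2" "0 < t0" "t0 \<le> t" "t0 \<le> s" "c \<le> 1"
    and close: "\<bar>t - s\<bar> \<le> 2 * (1 - c) * t0"
  shows "c * (q * p) - t * s \<le> c - (1 - c) * t0\<^sup>2"
proof -
  \<comment> \<open>\<open>q * p\<close> lies between \<open>1 + t * s\<close> (Cauchy--Schwarz) and \<open>1 + t * s + (t - s)\<^sup>2 / 2\<close>
    (arithmetic and geometric mean). The sign of \<open>c\<close> decides which side is needed.\<close>
  have "c * (q * p) - t * s \<le> c - (1 - c) * (t * s) + (t - s)\<^sup>2 / 2"
  proof (cases "c \<ge> 0")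
    case True
    have "2 * (q * p) \<le> q\<^sup>2 + p\<^sup>2"
      using sum_squares_bound[of q p] by simp
    also have "\<dots> = 2 * (1 + t * s) + (t - s)\<^sup>2"
      using assms(3,4) by (simp add: power2_eq_square algebra_simps)
    finally have "c * (q * p) \<le> c * (1 + t * s + (t - s)\<^sup>2 / 2)"
      using True by (intro mult_left_mono) auto
    moreover have "c * (t - s)\<^sup>2 \<le> 1 * (t - s)\<^sup>2"
      using assms(8) by (intro mult_right_mono) auto
    ultimately show ?thesis
      by (simp add: algebra_simps)
  next
    case False
    have "(1 + t * s)\<^sup>2 \<le> (1 + t * s)\<^sup>2 + (t - s)\<^sup>2"
      by simp
    also have "\<dots> = (q * p)\<^sup>2"
      unfolding power_mult_distrib assms(3,4) by (simp add: power2_eq_square algebra_simps)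
    finally have "1 + t * s \<le> q * p"
      by (rule power2_le_imp_le) (use assms(1,2) in simp)
    then have "c * (q * p) \<le> c * (1 + t * s)"
      using False by (intro mult_left_mono_neg) auto
    moreover have "0 \<le> (t - s)\<^sup>2 / 2"
      by simp
    ultimately show ?thesis
      by (simp only: algebra_simps)
  qed
  moreover have "(t - s)\<^sup>2 / 2 \<le> (1 - c) * (t * s - t0\<^sup>2)"
  proof -
    have "\<bar>t - s\<bar> * \<bar>t - s\<bar> \<le> (2 * (1 - c) * t0) * \<bar>t - s\<bar>"
      using close by (intro mult_right_mono) auto
    moreover have "t0 * \<bar>t - s\<bar> \<le> t * s - t0\<^sup>2"
    proof (cases "s \<le> t")
      case True
      have "t * t0 \<le> t * s"
        using assms by (intro mult_left_mono) auto
      moreover have "t0 * t0 \<le> t0 * s"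
        using assms by (intro mult_left_mono) auto
      ultimately show ?thesis
        using True by (simp add: power2_eq_square algebra_simps)
    next
      case False
      have "t0 * s \<le> t * s"
        using assms by (intro mult_right_mono) auto
      moreover have "t0 * t0 \<le> t0 * t"
        using assms by (intro mult_left_mono) auto
      ultimately show ?thesis
        using False by (simp add: power2_eq_square algebra_simps)
    qed
    then have "(1 - c) * (t0 * \<bar>t - s\<bar>) \<le> (1 - c) * (t * s - t0\<^sup>2)"
      using assms(8) by (intro mult_left_mono) auto
    ultimately have "\<bar>t - s\<bar> * \<bar>t - s\<bar> \<le> 2 * ((1 - c) * (t * s - t0\<^sup>2))"
      by linarith
    then show ?thesis
      by (simp add: power2_eq_square)
  qed
  ultimately show ?thesis
    by (simp add: algebra_simps)
qed

text \<open>Near the pole the cotangent is unbounded, so this part of the cap is treated separately. If both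
  heights are nonnegative and satisfy \<open>1 - h\<^sup>2 \<le> \<epsilon>\<close>, the scalar product is at least \<open>(1 - \<epsilon>) - \<epsilon>\<close>, since the horizontal
  parts have squared length at most \<open>\<epsilon>\<close>.\<close>

lemma code_near_pole_card_le_1:
  assumes "finite C" "C \<subseteq> unit_sphere (Suc m)"
    and sep: "\<And>x y. x \<in> C \<Longrightarrow> y \<in> C \<Longrightarrow> x \<noteq> y \<Longrightarrow> x \<bullet> y \<le> c"
    and pole: "\<And>x. x \<in> C \<Longrightarrow> 0 \<le> x $ m" "\<And>x. x \<in> C \<Longrightarrow> 1 - (x $ m)\<^sup>2 < (1 - c) / 2"
  shows "card C \<le> 1"
proof -
  have "x = y" if xy: "x \<in> C" "y \<in> C" for x y
  proof (rule ccontr)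
    assume "x \<noteq> y"
    then have "x \<bullet> y \<le> c"
      using sep xy by simp
    define \<epsilon> where "\<epsilon> = max (1 - (x $ m)\<^sup>2) (1 - (y $ m)\<^sup>2)"
    have d: "dim_vec x = Suc m" "dim_vec y = Suc m" "x \<bullet> x = 1" "y \<bullet> y = 1"
      using unit_sphereD[of _ "Suc m"] assms(2) xy by auto
    have "0 \<le> (\<Sum>i<m. (x $ i + y $ i)\<^sup>2)"
      by (simp add: sum_nonneg)
    also have "\<dots> = (x \<bullet> x - (x $ m)\<^sup>2) + (y \<bullet> y - (y $ m)\<^sup>2) + 2 * (x \<bullet> y - x $ m * y $ m)"
      using d(1,2) by (simp add: scalar_prod_Suc power2_eq_square algebra_simps sum.distrib
          sum_distrib_left)
    finally have "x $ m * y $ m - \<epsilon> \<le> x \<bullet> y"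
      using d by (simp add: \<epsilon>_def)
    moreover have "1 - \<epsilon> \<le> x $ m * y $ m"
    proof (cases "x $ m \<le> y $ m")
      case True
      then have "x $ m * x $ m \<le> x $ m * y $ m"
        using pole xy by (intro mult_left_mono) auto
      then show ?thesis by (simp add: \<epsilon>_def power2_eq_square)
    next
      case False
      then have "y $ m * y $ m \<le> x $ m * y $ m"
        using pole xy by (intro mult_right_mono) auto
      then show ?thesis by (simp add: \<epsilon>_def power2_eq_square)
    qed
    moreover have "\<epsilon> < (1 - c) / 2"
      using pole(2)[OF xy(1)] pole(2)[OF xy(2)] unfolding \<epsilon>_def by (rule max_less_iff_conj[THEN iffD2, OF conjI])
    ultimately show False
      using \<open>x \<bullet> y \<le> c\<close> by simp
  qed
  then show ?thesis
    using assms(1) by (simp add: card_le_Suc0_iff_eq)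
qed

text \<open>Projecting along meridians to the horizontal direction, for a code whose cotangents of polar
  angles (height divided by horizontal radius) lie in a window of the width allowed by
  \<open>radial_projection_bound\<close>.\<close>

lemma card_thin_strip_code_le:
  assumes "0 < \<phi>" "\<phi> < pi / 2" "0 < \<theta>" "\<theta> \<le> 2 * \<phi>"
    and "finite C" "C \<subseteq> unit_sphere (Suc m)"
    and sep: "\<And>x y. x \<in> C \<Longrightarrow> y \<in> C \<Longrightarrow> x \<noteq> y \<Longrightarrow> x \<bullet> y \<le> cos \<theta>"
    and cap: "\<And>x. x \<in> C \<Longrightarrow> cos \<phi> \<le> x $ m" "\<And>x. x \<in> C \<Longrightarrow> (x $ m)\<^sup>2 < 1"
    and thin: "\<And>x y. x \<in> C \<Longrightarrow> y \<in> C \<Longrightarrow>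
      \<bar>x $ m / sqrt (1 - (x $ m)\<^sup>2) - y $ m / sqrt (1 - (y $ m)\<^sup>2)\<bar> \<le> 2 * (1 - cos \<theta>) * cot \<phi>"
  shows "card C \<le> A_sphere m (omega \<theta> \<phi>)"
proof -
  define r where "r x = sqrt (1 - (x $ m)\<^sup>2)" for x :: "real vec"
  define t where "t x = x $ m / r x" for x :: "real vec"
  define f where "f x = vec m (\<lambda>i. x $ i / r x)" for x :: "real vec"
  have s: "0 < sin \<phi>" and c: "0 < cos \<phi>"
    using assms sin_gt_zero[of \<phi>] cos_gt_zero[of \<phi>] by auto
  note om = omega_properties[OF assms(1) less_imp_le[OF assms(2)] assms(3,4)]
  have r: "0 < r x" "(r x)\<^sup>2 = 1 - (x $ m)\<^sup>2" if "x \<in> C" for x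
    using cap(2)[OF that] by (auto simp: r_def)
  have q: "(1 / r x)\<^sup>2 = 1 + (t x)\<^sup>2" if "x \<in> C" for x
    using r[OF that] by (simp add: t_def power_divide field_simps)
  have t: "cot \<phi> \<le> t x" if "x \<in> C" for x
  proof -
    have "(cos \<phi>)\<^sup>2 \<le> (x $ m)\<^sup>2"
      using cap(1)[OF that] c by (intro power_mono) auto
    then have "(r x)\<^sup>2 \<le> (sin \<phi>)\<^sup>2"
      using r[OF that] by (simp add: sin_squared_eq)
    then have "r x \<le> sin \<phi>"
      using s by (meson less_imp_le power2_le_imp_le)
    then show ?thesis
      unfolding cot_def t_def using cap(1)[OF that] c s r[OF that] by (intro frac_le) auto
  qed
  have f_prod: "f x \<bullet> f y = (x \<bullet> y) * (1 / r x * (1 / r y)) - t x * t y" if "x \<in> C" "y \<in> C" for x y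
  proof -
    have "f x \<bullet> f y = (\<Sum>i<m. x $ i * y $ i) / (r x * r y)"
      by (simp add: scalar_prod_def f_def atLeast0LessThan sum_divide_distrib)
    moreover have "x \<bullet> y = (\<Sum>i<m. x $ i * y $ i) + x $ m * y $ m"
      using unit_sphereD(2)[of y "Suc m"] assms(6) that by (intro scalar_prod_Suc) auto
    ultimately show ?thesis
      by (simp add: t_def add_divide_distrib)
  qed
  show ?thesis
    unfolding A_sphere_def
  proof (rule card_le_max_code_size_image[OF om(1,2) assms(5)])
    fix x assume x: "x \<in> C"
    have "x \<bullet> x = 1"
      using unit_sphereD(3)[of x "Suc m"] assms(6) x by auto
    then have "f x \<bullet> f x = (1 / r x)\<^sup>2 - (t x)\<^sup>2"
      using f_prod[OF x x] by (simp add: power2_eq_square)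
    then have "f x \<bullet> f x = 1"
      using q[OF x] by simp
    then show "f x \<in> unit_sphere m"
      by (simp add: unit_sphere_def f_def)
    then show "f x \<in> unit_sphere m" .
  next
    fix x y assume xy: "x \<in> C" "y \<in> C" "x \<noteq> y"
    have "(x \<bullet> y) * (1 / r x * (1 / r y)) \<le> cos \<theta> * (1 / r x * (1 / r y))"
      using sep[OF xy] r[OF xy(1)] r[OF xy(2)] by (intro mult_right_mono) auto
    then have "f x \<bullet> f y \<le> cos \<theta> * (1 / r x * (1 / r y)) - t x * t y"
      using f_prod[OF xy(1,2)] by simp
    also have "\<dots> \<le> cos \<theta> - (1 - cos \<theta>) * (cot \<phi>)\<^sup>2"
      using r[OF xy(1)] r[OF xy(2)] q t xy(1,2) s c thin[OF xy(1,2)]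
      by (intro radial_projection_bound) (auto simp: t_def r_def cot_def)
    also have "\<dots> = (cos \<theta> * ((sin \<phi>)\<^sup>2 + (cos \<phi>)\<^sup>2) - (cos \<phi>)\<^sup>2) / (sin \<phi>)\<^sup>2"
      using s by (simp add: cot_def power_divide field_simps)
        (simp flip: distrib_left)
    also have "\<dots> = cos (omega \<theta> \<phi>)"
      by (simp add: om(3))
    finally show "f x \<bullet> f y \<le> cos (omega \<theta> \<phi>)" .
  qed
qed

text \<open>Outside the polar region the cotangent is bounded in terms of \<open>\<theta>\<close> alone, so the number of
  windows needed depends only on \<open>\<theta>\<close> and \<open>\<phi>\<close>, not on the dimension.\<close>

lemma A_cap_le_const_mult_A_sphere:
  assumes "0 < \<phi>" "\<phi> < pi / 2" "0 < \<theta>" "\<theta> \<le> 2 * \<phi>"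
  shows "\<exists>K. \<forall>m\<ge>1. A_cap (Suc m) \<theta> \<phi> \<le> K * A_sphere m (omega \<theta> \<phi>)"
proof -
  have \<theta>: "0 < \<theta>" "\<theta> \<le> pi"
    using assms by auto
  define \<delta> where "\<delta> = 2 * (1 - cos \<theta>) * cot \<phi>"
  define \<epsilon> where "\<epsilon> = (1 - cos \<theta>) / 4"
  define t where "t m x = x $ m / sqrt (1 - (x $ m)\<^sup>2)" for m and x :: "real vec"
  define M where "M = nat \<lfloor>1 / sqrt \<epsilon> / \<delta>\<rfloor>"
  have s: "0 < sin \<phi>" and c: "0 < cos \<phi>"
    using assms sin_gt_zero[of \<phi>] cos_gt_zero[of \<phi>] by auto
  have pos: "0 < \<delta>" "0 < \<epsilon>"
    using cos_less_one[OF \<theta>] s c by (auto simp: \<delta>_def \<epsilon>_def cot_def)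
  note om = omega_properties[OF assms(1) less_imp_le[OF assms(2)] assms(3,4)]
  have "A_cap (Suc m) \<theta> \<phi> \<le> (M + 2) * A_sphere m (omega \<theta> \<phi>)" if m: "m \<ge> 1" for m
  proof -
    obtain C where C: "spherical_code (Suc m) \<theta> C" "C \<subseteq> cap (Suc m) \<phi>"
      "card C = A_cap (Suc m) \<theta> \<phi>"
      using max_code_size_attained[OF \<theta>] unfolding A_cap_def by metis
    have C': "finite C" "C \<subseteq> unit_sphere (Suc m)"
      "\<And>x y. x \<in> C \<Longrightarrow> y \<in> C \<Longrightarrow> x \<noteq> y \<Longrightarrow> x \<bullet> y \<le> cos \<theta>"
      "\<And>x. x \<in> C \<Longrightarrow> cos \<phi> \<le> x $ m" "\<And>x. x \<in> C \<Longrightarrow> x $ m \<le> 1"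
      using C(1,2) \<theta> by (auto simp: spherical_code_iff cap_def strip_Suc_iff subset_iff)
    define P where "P = {x \<in> C. 1 - (x $ m)\<^sup>2 \<le> \<epsilon>}"
    define Q where "Q k = {x \<in> C. \<epsilon> < 1 - (x $ m)\<^sup>2 \<and> \<lfloor>t m x / \<delta>\<rfloor> = int k}" for k :: nat
    have "card P \<le> 1"
    proof (rule code_near_pole_card_le_1[of P m "cos \<theta>"])
      fix x assume "x \<in> P"
      then show "0 \<le> x $ m" "1 - (x $ m)\<^sup>2 < (1 - cos \<theta>) / 2"
        using C'(4)[of x] c pos by (auto simp: P_def \<epsilon>_def)
    qed (use C' in \<open>auto simp: P_def\<close>)
    moreover have "card (Q k) \<le> A_sphere m (omega \<theta> \<phi>)" for k
    proof (rule card_thin_strip_code_le[OF assms])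
      fix x y assume xy: "x \<in> Q k" "y \<in> Q k"
      then have "\<lfloor>t m x / \<delta>\<rfloor> = \<lfloor>t m y / \<delta>\<rfloor>"
        by (simp add: Q_def)
      then have "\<bar>t m x / \<delta> - t m y / \<delta>\<bar> \<le> 1"
        by linarith
      then have "\<bar>t m x - t m y\<bar> \<le> \<delta>"
        using pos(1) by (simp add: diff_divide_distrib[symmetric] abs_divide)
      then show "\<bar>x $ m / sqrt (1 - (x $ m)\<^sup>2) - y $ m / sqrt (1 - (y $ m)\<^sup>2)\<bar>
          \<le> 2 * (1 - cos \<theta>) * cot \<phi>"
        by (simp add: t_def \<delta>_def)
    qed (use C' pos in \<open>auto simp: Q_def\<close>)
    moreover have "C \<subseteq> P \<union> (\<Union>k\<in>{..M}. Q k)"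
    proof
      fix x assume x: "x \<in> C"
      show "x \<in> P \<union> (\<Union>k\<in>{..M}. Q k)"
      proof (cases "x \<in> P")
        case False
        then have e: "\<epsilon> < 1 - (x $ m)\<^sup>2"
          using x by (simp add: P_def)
        have "0 \<le> t m x"
          using C'(4)[OF x] c e pos by (simp add: t_def)
        moreover have "t m x \<le> 1 / sqrt \<epsilon>"
          unfolding t_def using C'(5)[OF x] e pos by (intro frac_le) auto
        ultimately have "0 \<le> \<lfloor>t m x / \<delta>\<rfloor>" "\<lfloor>t m x / \<delta>\<rfloor> \<le> \<lfloor>1 / sqrt \<epsilon> / \<delta>\<rfloor>"
          using pos(1) by (auto intro!: floor_mono divide_right_mono simp del: divide_divide_eq_left)
        then have "x \<in> Q (nat \<lfloor>t m x / \<delta>\<rfloor>)" "nat \<lfloor>t m x / \<delta>\<rfloor> \<le> M"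
          using x e by (auto simp: Q_def M_def)
        then show ?thesis by blast
      qed simp
    qed
    then have "card C \<le> card (P \<union> (\<Union>k\<in>{..M}. Q k))"
      using C'(1) by (intro card_mono) (auto simp: P_def Q_def)
    moreover have "card (P \<union> (\<Union>k\<in>{..M}. Q k)) \<le> card P + (\<Sum>k\<in>{..M}. card (Q k))"
      by (rule order_trans[OF card_Un_le add_left_mono[OF card_UN_le]]) simp
    moreover have "(\<Sum>k\<in>{..M}. card (Q k)) \<le> (M + 1) * A_sphere m (omega \<theta> \<phi>)"
      using sum_bounded_above[of "{..M}" "\<lambda>k. card (Q k)" "A_sphere m (omega \<theta> \<phi>)"] calculation(2)
      by simp
    ultimately show ?thesis
      using A_sphere_pos[OF om(1,2) m] C(3) by simp
  qed
  then show ?thesis by blast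
qed

section \<open>Exponential rates\<close>

text \<open>Passing from dimension \<open>n\<close> to \<open>n + 1\<close> multiplies the normalised logarithm by \<open>n / (n + 1)\<close>, and
  a constant factor \<open>exp L\<close> in the size adds \<open>L / (n + 1)\<close>. Neither is visible in the limit, even
  for infinite rates.\<close>

lemma rate_shift:
  fixes u :: "nat \<Rightarrow> ereal" and L :: real
  shows "limsup (\<lambda>n. ereal (L / real (Suc n)) + ereal (real n / real (Suc n)) * u n) = limsup u"
    and "liminf (\<lambda>n. ereal (L / real (Suc n)) + ereal (real n / real (Suc n)) * u n) = liminf u"
proof -
  have "(\<lambda>n. L / real (Suc n)) \<longlonglongrightarrow> 0"
    using LIMSEQ_Suc[OF lim_const_over_n] .
  then have 1: "(\<lambda>n. ereal (L / real (Suc n))) \<longlonglongrightarrow> 0"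
    by (simp add: zero_ereal_def)
  have 2: "(\<lambda>n. ereal (real n / real (Suc n))) \<longlonglongrightarrow> 1"
    using LIMSEQ_n_over_Suc_n[where 'a=real] by (simp add: one_ereal_def)
  show "limsup (\<lambda>n. ereal (L / real (Suc n)) + ereal (real n / real (Suc n)) * u n) = limsup u"
    using ereal_limsup_lim_add[OF 1] ereal_limsup_lim_mult[OF 2] by simp
  show "liminf (\<lambda>n. ereal (L / real (Suc n)) + ereal (real n / real (Suc n)) * u n) = liminf u"
    using ereal_liminf_lim_add[OF 1] ereal_liminf_lim_mult[OF 2] by simp
qed

lemma rate_le_shift:
  assumes "\<And>m. m \<ge> 1 \<Longrightarrow> 1 \<le> a m \<and> a m \<le> b (Suc m)"
  shows "upper_rate a \<le> upper_rate b" "lower_rate a \<le> lower_rate b"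
proof -
  define u where "u n = ereal (1 / real n * ln (real (a n)))" for n
  define v where "v n = ereal (1 / real n * ln (real (b n)))" for n
  have "ereal (0 / real (Suc n)) + ereal (real n / real (Suc n)) * u n \<le> v (n + 1)" if "n \<ge> 1" for n
    using assms[OF that] that by (auto simp: u_def v_def intro!: divide_right_mono)
  then have ev: "\<forall>\<^sub>F n in sequentially.
      ereal (0 / real (Suc n)) + ereal (real n / real (Suc n)) * u n \<le> v (n + 1)"
    using eventually_sequentially by blast
  show "upper_rate a \<le> upper_rate b"
    using Limsup_mono[OF ev] unfolding rate_shift limsup_shift
    by (simp add: upper_rate_def u_def[abs_def] v_def[abs_def])
  show "lower_rate a \<le> lower_rate b"
    using Liminf_mono[OF ev] unfolding rate_shift liminf_shift
    by (simp add: lower_rate_def u_def[abs_def] v_def[abs_def])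
qed

lemma rate_ge_shift:
  assumes "\<And>m. m \<ge> 1 \<Longrightarrow> 1 \<le> a m \<and> 1 \<le> b (Suc m) \<and> b (Suc m) \<le> K * a m"
  shows "upper_rate b \<le> upper_rate a" "lower_rate b \<le> lower_rate a"
proof -
  define u where "u n = ereal (1 / real n * ln (real (a n)))" for n
  define v where "v n = ereal (1 / real n * ln (real (b n)))" for n
  have K: "K > 0"
    using assms[of 1] by (cases K) auto
  have "v (n + 1) \<le> ereal (ln K / real (Suc n)) + ereal (real n / real (Suc n)) * u n"
    if n: "n \<ge> 1" for n
  proof -
    have "real (b (Suc n)) \<le> real K * real (a n)"
      using assms[OF n] by (metis of_nat_le_iff of_nat_mult)
    then have "ln (real (b (Suc n))) \<le> ln (real K * real (a n))"
      using assms[OF n] K by (subst ln_le_cancel_iff) auto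
    also have "\<dots> = ln K + ln (real (a n))"
      using assms[OF n] K by (intro ln_mult_pos) auto
    finally show ?thesis
      using n by (auto simp: u_def v_def add_divide_distrib[symmetric] intro!: divide_right_mono)
  qed
  then have ev: "\<forall>\<^sub>F n in sequentially.
      v (n + 1) \<le> ereal (ln K / real (Suc n)) + ereal (real n / real (Suc n)) * u n"
    using eventually_sequentially by blast
  show "upper_rate b \<le> upper_rate a"
    using Limsup_mono[OF ev] unfolding rate_shift limsup_shift
    by (simp add: upper_rate_def u_def[abs_def] v_def[abs_def])
  show "lower_rate b \<le> lower_rate a"
    using Liminf_mono[OF ev] unfolding rate_shift liminf_shift
    by (simp add: lower_rate_def u_def[abs_def] v_def[abs_def])
qed

lemma rate_mono:
  assumes "\<And>n. n \<ge> 2 \<Longrightarrow> 1 \<le> a n \<and> a n \<le> b n"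
  shows "upper_rate a \<le> upper_rate b" "lower_rate a \<le> lower_rate b"
proof -
  have ev: "\<forall>\<^sub>F n in sequentially.
      ereal (1 / real n * ln (real (a n))) \<le> ereal (1 / real n * ln (real (b n)))"
    unfolding eventually_sequentially
    using assms by (intro exI[of _ 2]) (force intro!: divide_right_mono)
  show "upper_rate a \<le> upper_rate b" "lower_rate a \<le> lower_rate b"
    unfolding upper_rate_def lower_rate_def using Limsup_mono[OF ev] Liminf_mono[OF ev] by auto
qed

theorem theorem8:
  fixes \<psi> \<phi> \<theta> :: real
  assumes "0 \<le> \<psi>" and "\<psi> < \<phi>" and "\<phi> \<le> pi / 2"
    and "0 < \<theta>" and "\<theta> \<le> 2 * \<phi>"
  shows "R_upper_strip \<theta> \<psi> \<phi> = R_upper_cap \<theta> \<phi> \<and>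
         R_upper_cap \<theta> \<phi> = R_upper (omega \<theta> \<phi>) \<and>
         R_lower_strip \<theta> \<psi> \<phi> = R_lower_cap \<theta> \<phi> \<and>
         R_lower_cap \<theta> \<phi> = R_lower (omega \<theta> \<phi>)"
proof -
  let ?S = "\<lambda>n. A_sphere n (omega \<theta> \<phi>)" and ?Z = "\<lambda>n. A_strip n \<theta> \<psi> \<phi>"
    and ?C = "\<lambda>n. A_cap n \<theta> \<phi>"
  have \<phi>: "0 < \<phi>" and \<theta>: "0 < \<theta>" "\<theta> \<le> pi"
    using assms by auto
  note om = omega_properties[OF \<phi> assms(3-5)]
  have S: "1 \<le> ?S m" if "m \<ge> 1" for m
    using A_sphere_pos[OF om(1,2) that] .
  have SZ: "?S m \<le> ?Z (Suc m)" for m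
    using A_sphere_le_A_strip[OF assms] .
  have ZC: "?Z n \<le> ?C n" for n
    unfolding A_strip_def A_cap_def
    by (intro max_code_size_mono \<theta>) (auto simp: cap_def strip_def intro: order_trans)
  have Z: "1 \<le> ?Z n" if n: "n \<ge> 2" for n
  proof -
    obtain m where "n = Suc m" "m \<ge> 1"
      using n by (cases n) auto
    then show ?thesis
      using S[of m] SZ[of m] by simp
  qed
  have SZ_rates: "upper_rate ?S \<le> upper_rate ?Z" "lower_rate ?S \<le> lower_rate ?Z"
    by (rule rate_le_shift; use S SZ in blast)+
  have ZC_rates: "upper_rate ?Z \<le> upper_rate ?C" "lower_rate ?Z \<le> lower_rate ?C"
    by (rule rate_mono; use Z ZC in blast)+
  have C: "1 \<le> ?C n" if "n \<ge> 2" for n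
    using Z[OF that] ZC[of n] by linarith
  have CS_rates: "upper_rate ?C \<le> upper_rate ?S \<and> lower_rate ?C \<le> lower_rate ?S"
  proof (cases "\<phi> = pi / 2")
    case True
    have "omega \<theta> \<phi> = \<theta>"
      unfolding omega_def True using \<theta> by (simp add: arccos_cos)
    then have "?C n \<le> ?S n" for n
      unfolding A_sphere_def A_cap_def
      by (auto simp: cap_def strip_def intro!: max_code_size_mono \<theta>)
    with C show ?thesis
      by (intro conjI rate_mono) auto
  next
    case False
    then have "\<phi> < pi / 2"
      using assms(3) by simp
    then obtain K where "\<forall>m\<ge>1. ?C (Suc m) \<le> K * ?S m"
      using A_cap_le_const_mult_A_sphere[OF \<phi> _ assms(4,5)] by blast
    then have K: "1 \<le> ?S m \<and> 1 \<le> ?C (Suc m) \<and> ?C (Suc m) \<le> K * ?S m" if "m \<ge> 1" for m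
      using S[OF that] C[of "Suc m"] that by auto
    show ?thesis
      using rate_ge_shift[of ?S ?C K, OF K] by auto
  qed
  then show ?thesis
    using SZ_rates ZC_rates
    unfolding R_upper_strip_def R_upper_cap_def R_upper_def R_lower_strip_def R_lower_cap_def
      R_lower_def by auto
qed

end
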